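(* Let $\mathfrak g$ be an irreducible finite-dimensional Lie algebra over $\mathbb K=\mathbb R$ or $\mathbb C$, and let $\{e_1,\dots,e_n\}$ be a basis of $\mathfrak g$ that diagonalizes the Nikolayevsky derivation $N$ of $\mathfrak g$. Assume that there exists an ad-invariant metric $g$ on $\mathfrak g$ which is $\sigma$-diagonal with respect to this basis. Then the metric Nikolayevsky derivation of $(\mathfrak g,g)$ coincides with the Nikolayevsky derivation $N$ (that is, $N$ is a metric Nikolayevsky derivation of $(\mathfrak g,g)$).
   Context: A metric on $\mathfrak g$ is a nondegenerate symmetric $\mathbb K$-bilinear form $g$; it is ad-invariant if $g([X,Y],Z)=-g(Y,[X,Z])$ for all $X,Y,Z\in\mathfrak g$. A Lie algebra is irreducible if it is not a direct sum of two nontrivial ideals. A metric $g$ is $\sigma$-diagonal with respect to a basis $e_1,\dots,e_n$ (with dual basis $e^1,\dots,e^n$) if there is a permutation $\sigma$ of $\{1,\dots,n\}$ with $\sigma^2=\mathrm{id}$ such that $g=\sum_i g_i\, e^i\odot e^{\sigma_i}$ with $g_i\in\mathbb K^*$; equivalently, $g(e_i,e_j)\neq0$ if and only if $j=\sigma_i$. A Nikolayevsky derivation of $\mathfrak g$ is a semisimple derivation $N$ of $\mathfrak g$ such that $\mathrm{tr}(N\psi)=\mathrm{tr}(\psi)$ for all $\psi\in\mathrm{Der}(\mathfrak g)$; it always exists and is unique up to automorphisms. Let $\mathfrak{co}(\mathfrak g,g)=\{f\in\mathfrak{gl}(\mathfrak g): \exists\, l\in\mathbb K,\ g(fX,Y)+g(X,fY)=l\,g(X,Y)\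 \forall X,Y\in\mathfrak g\}$. A metric Nikolayevsky derivation of $(\mathfrak g,g)$ is a semisimple derivation $N\in\mathfrak{co}(\mathfrak g,g)\cap\mathrm{Der}(\mathfrak g)$ such that $\mathrm{tr}(N\psi)=\mathrm{tr}(\psi)$ for every $\psi\in\mathfrak{co}(\mathfrak g,g)\cap\mathrm{Der}(\mathfrak g)$; it always exists and is unique up to conjugation by automorphisms of $\mathfrak g$ preserving $g$ up to a scalar factor. *)

theory Defs
  imports "HOL-Analysis.Analysis" "HOL-Combinatorics.Permutations"
begin

text \<open>
  The base field is of class \<^class>\<open>real_normed_field\<close>. Its instances include the types of real
  and of complex numbers, and by the theorem of Gelfand and Mazur every instance is isomorphic to
  one of these two. The norm itself plays no role.
\<close>

locale finite_dim_lie_algebra = vector_space scale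
  for scale :: "'k::real_normed_field \<Rightarrow> 'a::ab_group_add \<Rightarrow> 'a"  (infixr \<open>*s\<close> 75) +
  fixes bracket :: "'a \<Rightarrow> 'a \<Rightarrow> 'a"
  assumes linear_bracket_right: "Vector_Spaces.linear scale scale (\<lambda>y. bracket x y)"
    and linear_bracket_left: "Vector_Spaces.linear scale scale (\<lambda>x. bracket x y)"
    and bracket_self: "bracket x x = 0"
    and jacobi: "bracket x (bracket y z) + bracket y (bracket z x) + bracket z (bracket x y) = 0"
    and finite_dim: "\<exists>B. finite B \<and> span B = UNIV"
begin

abbreviation endo :: "('a \<Rightarrow> 'a) \<Rightarrow> bool" where
  "endo f \<equiv> Vector_Spaces.linear scale scale f"

definition direct_sum :: "'a set \<Rightarrow> 'a set \<Rightarrow> bool" where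
  "direct_sum U W \<longleftrightarrow> U \<inter> W = {0} \<and> (\<forall>x. \<exists>u\<in>U. \<exists>w\<in>W. x = u + w)"

definition lie_ideal :: "'a set \<Rightarrow> bool" where
  "lie_ideal I \<longleftrightarrow> subspace I \<and> (\<forall>x. \<forall>y\<in>I. bracket x y \<in> I)"

definition lie_irreducible :: bool where
  "lie_irreducible \<longleftrightarrow>
    \<not> (\<exists>I J. lie_ideal I \<and> lie_ideal J \<and> I \<noteq> {0} \<and> J \<noteq> {0} \<and> direct_sum I J)"

definition derivation :: "('a \<Rightarrow> 'a) \<Rightarrow> bool" where
  "derivation D \<longleftrightarrow> endo D \<and> (\<forall>x y. D (bracket x y) = bracket (D x) y + bracket x (D y))"

text \<open>
  Semisimplicity means that every invariant subspace has an invariant complement. In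
  characteristic zero this is diagonalizability over the algebraic closure; over the reals it does
  not require real eigenvalues.
\<close>

definition semisimple :: "('a \<Rightarrow> 'a) \<Rightarrow> bool" where
  "semisimple f \<longleftrightarrow> endo f \<and>
    (\<forall>U. subspace U \<and> f ` U \<subseteq> U \<longrightarrow> (\<exists>W. subspace W \<and> f ` W \<subseteq> W \<and> direct_sum U W))"

text \<open>
  The trace is read off from one chosen basis, namely an extension of the empty set. It does not
  depend on this choice, see \<open>tr_eq_basis\<close> below.
\<close>

definition tr :: "('a \<Rightarrow> 'a) \<Rightarrow> 'k" where
  "tr f = (let B = extend_basis {} in \<Sum>b\<in>B. representation B (f b) b)"

definition nikolayevsky :: "('a \<Rightarrow> 'a) \<Rightarrow> bool" where
  "nikolayevsky N \<longleftrightarrow> derivation N \<and> semisimple N \<and> (\<forall>\<psi>. derivation \<psi> \<longrightarrow> tr (N \<circ> \<psi>) = tr \<psi>)"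

definition metric_form :: "('a \<Rightarrow> 'a \<Rightarrow> 'k) \<Rightarrow> bool" where
  "metric_form g \<longleftrightarrow>
    (\<forall>x. Vector_Spaces.linear scale (*) (\<lambda>y. g x y)) \<and>
    (\<forall>y. Vector_Spaces.linear scale (*) (\<lambda>x. g x y)) \<and>
    (\<forall>x y. g x y = g y x) \<and>
    (\<forall>x. (\<forall>y. g x y = 0) \<longrightarrow> x = 0)"

definition ad_invariant :: "('a \<Rightarrow> 'a \<Rightarrow> 'k) \<Rightarrow> bool" where
  "ad_invariant g \<longleftrightarrow> (\<forall>x y z. g (bracket x y) z = - g y (bracket x z))"

definition co :: "('a \<Rightarrow> 'a \<Rightarrow> 'k) \<Rightarrow> ('a \<Rightarrow> 'a) set" where
  "co g = {f. endo f \<and> (\<exists>l. \<forall>x y. g (f x) y + g x (f y) = l * g x y)}"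

definition metric_nikolayevsky :: "('a \<Rightarrow> 'a \<Rightarrow> 'k) \<Rightarrow> ('a \<Rightarrow> 'a) \<Rightarrow> bool" where
  "metric_nikolayevsky g N \<longleftrightarrow> N \<in> co g \<and> derivation N \<and> semisimple N \<and>
    (\<forall>\<psi>. \<psi> \<in> co g \<and> derivation \<psi> \<longrightarrow> tr (N \<circ> \<psi>) = tr \<psi>)"

definition indexed_basis :: "nat \<Rightarrow> (nat \<Rightarrow> 'a) \<Rightarrow> bool" where
  "indexed_basis n e \<longleftrightarrow>
    inj_on e {1..n} \<and> independent (e ` {1..n}) \<and> span (e ` {1..n}) = UNIV"

definition diagonalizes :: "nat \<Rightarrow> (nat \<Rightarrow> 'a) \<Rightarrow> ('a \<Rightarrow> 'a) \<Rightarrow> bool" where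
  "diagonalizes n e f \<longleftrightarrow> (\<forall>i\<in>{1..n}. \<exists>c. f (e i) = c *s e i)"

definition dual_basis :: "nat \<Rightarrow> (nat \<Rightarrow> 'a) \<Rightarrow> nat \<Rightarrow> 'a \<Rightarrow> 'k" where
  "dual_basis n e i = (\<lambda>x. representation (e ` {1..n}) x (e i))"

text \<open>
  The normalization of the symmetric product is immaterial for \<open>sigma_diagonal\<close>, since
  the factor 1/2 can be absorbed into the coefficients.
\<close>

definition sym_prod :: "('a \<Rightarrow> 'k) \<Rightarrow> ('a \<Rightarrow> 'k) \<Rightarrow> 'a \<Rightarrow> 'a \<Rightarrow> 'k" where
  "sym_prod \<alpha> \<beta> x y = (\<alpha> x * \<beta> y + \<beta> x * \<alpha> y) / 2"

definition sigma_diagonal :: "nat \<Rightarrow> (nat \<Rightarrow> 'a) \<Rightarrow> ('a \<Rightarrow> 'a \<Rightarrow> 'k) \<Rightarrow> bool" where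
  "sigma_diagonal n e g \<longleftrightarrow>
    (\<exists>\<sigma> c. \<sigma> permutes {1..n} \<and> \<sigma> \<circ> \<sigma> = id \<and> (\<forall>i\<in>{1..n}. c i \<noteq> 0) \<and>
      (\<forall>x y. g x y = (\<Sum>i\<in>{1..n}. c i * sym_prod (dual_basis n e i) (dual_basis n e (\<sigma> i)) x y)))"

lemma tr_eq_basis:
  assumes f: "endo f" and B: "independent B" "span B = UNIV"
  shows "tr f = (\<Sum>b\<in>B. representation B (f b) b)"
proof -
  have fin: "finite S" if "independent S" for S
    using finite_dim that independent_span_bound by blast
  define C where "C = extend_basis {}"
  have C: "independent C" "span C = UNIV"
    unfolding C_def by (simp_all add: independent_extend_basis span_extend_basis independent_empty)
  interpret F: Vector_Spaces.linear scale scale f by (rule f)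
  have lin: "Vector_Spaces.linear scale (*) (\<lambda>v. representation S v b)"
    if "independent S" "span S = UNIV" for S b
    using that by (rule linear_representation)
  have exp: "\<phi> v = (\<Sum>c\<in>S. representation S v c * \<phi> c)"
    if S: "independent S" "span S = UNIV" and p: "Vector_Spaces.linear scale (*) \<phi>" for S v \<phi>
  proof -
    interpret P: Vector_Spaces.linear scale "(*)" \<phi> by (rule p)
    have "\<phi> v = \<phi> (\<Sum>c\<in>S. representation S v c *s c)"
      using sum_representation_eq[OF S(1) _ fin[OF S(1)]] S(2) by simp
    then show ?thesis by (simp add: P.sum P.scale)
  qed
  have comp: "Vector_Spaces.linear scale (*) (\<lambda>v. representation S (f v) b)"
    if "independent S" "span S = UNIV" for S b
    using Vector_Spaces.linear_compose[OF f lin[OF that]] by (simp add: o_def)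
  have "(\<Sum>b\<in>B. representation B (f b) b) =
      (\<Sum>b\<in>B. \<Sum>c\<in>C. representation C b c * representation B (f c) b)"
    by (rule sum.cong[OF refl], rule exp[OF C comp[OF B]])
  also have "\<dots> = (\<Sum>c\<in>C. \<Sum>b\<in>B. representation B (f c) b * representation C b c)"
    by (subst sum.swap) (simp add: mult.commute)
  also have "\<dots> = (\<Sum>c\<in>C. representation C (f c) c)"
    by (rule sum.cong[OF refl], rule exp[OF B lin[OF C], symmetric])
  finally show ?thesis by (simp add: tr_def C_def Let_def)
qed

lemma dual_basis_apply:
  assumes "indexed_basis n e" "i \<in> {1..n}" "j \<in> {1..n}"
  shows "dual_basis n e i (e j) = (if i = j then 1 else 0)"
proof -
  have inj: "inj_on e {1..n}" and ind: "independent (e ` {1..n})"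
    using assms(1) by (auto simp: indexed_basis_def)
  have "representation (e ` {1..n}) (e j) = (\<lambda>v. if v = e j then 1 else 0)"
    by (rule representation_basis[OF ind]) (use assms in blast)
  then show ?thesis
    using inj_on_eq_iff[OF inj assms(2,3)] by (simp add: dual_basis_def)
qed

lemma indexed_basis_expansion:
  assumes "indexed_basis n e"
  shows "x = (\<Sum>i\<in>{1..n}. dual_basis n e i x *s e i)"
proof -
  have "x = (\<Sum>b\<in>e ` {1..n}. representation (e ` {1..n}) x b *s b)"
    by (rule sum_representation_eq[symmetric]) (use assms in \<open>auto simp: indexed_basis_def\<close>)
  also have "\<dots> = (\<Sum>i\<in>{1..n}. dual_basis n e i x *s e i)"
    using assms by (subst sum.reindex) (auto simp: indexed_basis_def dual_basis_def)
  finally show ?thesis .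
qed

lemma sigma_diagonal_iff:
  assumes e: "indexed_basis n e" and g: "metric_form g"
  shows "sigma_diagonal n e g \<longleftrightarrow>
    (\<exists>\<sigma>. \<sigma> permutes {1..n} \<and> \<sigma> \<circ> \<sigma> = id \<and>
      (\<forall>i\<in>{1..n}. \<forall>j\<in>{1..n}. g (e i) (e j) \<noteq> 0 \<longleftrightarrow> j = \<sigma> i))" (is "?L \<longleftrightarrow> ?R")
proof -
  let ?d = "dual_basis n e"
  have gexp: "g x y = (\<Sum>i\<in>{1..n}. \<Sum>j\<in>{1..n}. ?d i x * ?d j y * g (e i) (e j))" for x y
  proof -
    interpret L: Vector_Spaces.linear scale "(*)" "\<lambda>x. g x y"
      using g by (simp add: metric_form_def)
    interpret R: Vector_Spaces.linear scale "(*)" "\<lambda>y. g u y" for u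
      using g by (simp add: metric_form_def)
    have "g x y = g (\<Sum>i\<in>{1..n}. ?d i x *s e i) y"
      using indexed_basis_expansion[OF e, of x] by simp
    also have "\<dots> = (\<Sum>i\<in>{1..n}. ?d i x * g (e i) y)"
      by (simp add: L.sum L.scale)
    also have "\<dots> = (\<Sum>i\<in>{1..n}. ?d i x * g (e i) (\<Sum>j\<in>{1..n}. ?d j y *s e j))"
      using indexed_basis_expansion[OF e, of y] by simp
    also have "\<dots> = (\<Sum>i\<in>{1..n}. \<Sum>j\<in>{1..n}. ?d i x * ?d j y * g (e i) (e j))"
      by (simp add: R.sum R.scale sum_distrib_left mult.assoc)
    finally show ?thesis .
  qed
  have ndeg: "\<exists>j\<in>{1..n}. g (e i) (e j) \<noteq> 0" if i: "i \<in> {1..n}" for i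
  proof (rule ccontr)
    assume "\<not> ?thesis"
    then have z: "\<forall>j\<in>{1..n}. g (e i) (e j) = 0" by blast
    have "g (e i) y = 0" for y
      unfolding gexp[of "e i" y]
      by (intro sum.neutral ballI) (use z i e in \<open>auto simp: dual_basis_apply\<close>)
    then have "e i = 0" using g by (simp add: metric_form_def)
    moreover have "e i \<noteq> 0"
      using e i dependent_zero[of "e ` {1..n}"] by (force simp: indexed_basis_def)
    ultimately show False by simp
  qed
  show ?thesis
  proof
    assume ?L
    then obtain \<sigma> c where s: "\<sigma> permutes {1..n}" "\<sigma> \<circ> \<sigma> = id"
      and gc: "\<And>x y. g x y = (\<Sum>i\<in>{1..n}. c i * sym_prod (?d i) (?d (\<sigma> i)) x y)"
      unfolding sigma_diagonal_def by blast
    have ss: "\<sigma> (\<sigma> i) = i" for i using s(2) by (metis comp_apply id_apply)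
    have "j = \<sigma> i" if "i \<in> {1..n}" "j \<in> {1..n}" "g (e i) (e j) \<noteq> 0" for i j
    proof (rule ccontr)
      assume ne: "j \<noteq> \<sigma> i"
      have "g (e i) (e j) = 0"
        unfolding gc
      proof (intro sum.neutral ballI)
        fix k assume k: "k \<in> {1..n}"
        then have "\<sigma> k \<in> {1..n}" using s(1) by (simp only: permutes_in_image)
        then show "c k * sym_prod (?d k) (?d (\<sigma> k)) (e i) (e j) = 0"
          using that k ne ss
          by (auto simp: sym_prod_def dual_basis_apply[OF e])
      qed
      with that show False by simp
    qed
    with ndeg s show ?R by metis
  next
    assume ?R
    then obtain \<sigma> where s: "\<sigma> permutes {1..n}" "\<sigma> \<circ> \<sigma> = id"
      and gs: "\<And>i j. i \<in> {1..n} \<Longrightarrow> j \<in> {1..n} \<Longrightarrow> g (e i) (e j) \<noteq> 0 \<longleftrightarrow> j = \<sigma> i"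
      by blast
    have ss: "\<sigma> (\<sigma> i) = i" for i using s(2) by (metis comp_apply id_apply)
    have sin: "\<sigma> i \<in> {1..n}" if "i \<in> {1..n}" for i
      using s(1) that by (simp only: permutes_in_image)
    let ?c = "\<lambda>i. g (e i) (e (\<sigma> i))"
    have sym: "?c (\<sigma> i) = ?c i" for i using g ss by (simp add: metric_form_def)
    have A: "g x y = (\<Sum>i\<in>{1..n}. ?c i * (?d i x * ?d (\<sigma> i) y))" for x y
    proof -
      have "g x y = (\<Sum>i\<in>{1..n}. \<Sum>j\<in>{1..n}. if j = \<sigma> i then ?d i x * ?d j y * g (e i) (e j) else 0)"
        unfolding gexp[of x y] by (intro sum.cong refl) (use gs in auto)
      also have "\<dots> = (\<Sum>i\<in>{1..n}. ?d i x * ?d (\<sigma> i) y * ?c i)"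
        by (intro sum.cong refl) (use sin in \<open>simp add: sum.delta\<close>)
      finally show ?thesis by (simp add: mult_ac)
    qed
    have Bq: "g x y = (\<Sum>i\<in>{1..n}. ?c i * (?d (\<sigma> i) x * ?d i y))" for x y
      unfolding A[of x y]
      by (subst sum.permute[OF s(1)]) (simp add: o_def ss sym g[unfolded metric_form_def])
    have "g x y = (\<Sum>i\<in>{1..n}. ?c i * sym_prod (?d i) (?d (\<sigma> i)) x y)" for x y
    proof -
      have "(\<Sum>i\<in>{1..n}. ?c i * sym_prod (?d i) (?d (\<sigma> i)) x y) =
          ((\<Sum>i\<in>{1..n}. ?c i * (?d i x * ?d (\<sigma> i) y)) +
           (\<Sum>i\<in>{1..n}. ?c i * (?d (\<sigma> i) x * ?d i y))) / 2"
        by (simp add: sym_prod_def sum.distrib[symmetric] sum_divide_distrib distrib_left)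
      also have "\<dots> = (g x y + g x y) / 2"
        by (simp only: A[of x y, symmetric] Bq[of x y, symmetric])
      finally have "(\<Sum>i\<in>{1..n}. ?c i * sym_prod (?d i) (?d (\<sigma> i)) x y) = (g x y + g x y) / 2" .
      then show ?thesis by simp
    qed
    then show ?L unfolding sigma_diagonal_def
      using s gs sin by (intro exI[of _ \<sigma>] exI[of _ ?c]) blast
  qed
qed

end

end

theory Submission
  imports Defs
begin

text \<open>
  Let \<open>\<phi> = N + N\<^sup>*\<close>, where \<open>N\<^sup>*\<close> is the adjoint of the derivation \<open>N\<close>. Since \<open>N\<close> is a derivation,
  \<open>g([x, y], \<phi> z) = g([N x, y], z) + g([x, N y], z) + g([x, y], N z)\<close>, and the right-hand side is
  alternating in \<open>x, y, z\<close> by ad-invariance; hence \<open>\<phi>\<close> commutes with all \<open>ad x\<close> and its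
  eigenspaces are ideals. As \<open>g\<close> is \<open>\<sigma>\<close>-diagonal, \<open>\<phi>\<close> is diagonal in the basis \<open>e\<close>, so \<open>\<phi>\<close>
  is scalar by irreducibility, which says that \<open>N\<close> lies in \<open>co g\<close>.
\<close>

context finite_dim_lie_algebra
begin

lemma metric_form_left: "metric_form g \<Longrightarrow> Vector_Spaces.linear scale (*) (\<lambda>x. g x y)"
  and metric_form_right: "metric_form g \<Longrightarrow> Vector_Spaces.linear scale (*) (g x)"
  unfolding metric_form_def by blast+

lemma metric_form_add_left: "metric_form g \<Longrightarrow> g (x + x') y = g x y + g x' y"
  using module_hom.add[OF Vector_Spaces.linear.axioms(3)[OF metric_form_left]] .

lemma metric_form_add_right: "metric_form g \<Longrightarrow> g x (y + y') = g x y + g x y'"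
  using module_hom.add[OF Vector_Spaces.linear.axioms(3)[OF metric_form_right]] .

lemma metric_form_scale_left: "metric_form g \<Longrightarrow> g (c *s x) y = c * g x y"
  using module_hom.scale[OF Vector_Spaces.linear.axioms(3)[OF metric_form_left]] .

lemma metric_form_scale_right: "metric_form g \<Longrightarrow> g x (c *s y) = c * g x y"
  using module_hom.scale[OF Vector_Spaces.linear.axioms(3)[OF metric_form_right]] .

lemma metric_form_sum_left: "metric_form g \<Longrightarrow> g (sum f A) y = (\<Sum>i\<in>A. g (f i) y)"
  using module_hom.sum[OF Vector_Spaces.linear.axioms(3)[OF metric_form_left]] .

lemma metric_form_sum_right: "metric_form g \<Longrightarrow> g x (sum f A) = (\<Sum>i\<in>A. g x (f i))"
  using module_hom.sum[OF Vector_Spaces.linear.axioms(3)[OF metric_form_right]] .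

text \<open>The form \<open>(x, y) \<mapsto> g (\<phi> x) y\<close>, which needs no construction of the adjoint.\<close>

definition sym_part :: "('a \<Rightarrow> 'a \<Rightarrow> 'k) \<Rightarrow> ('a \<Rightarrow> 'a) \<Rightarrow> 'a \<Rightarrow> 'a \<Rightarrow> 'k" where
  "sym_part g f x y = g (f x) y + g x (f y)"

text \<open>Expanding \<open>D\<close> on both brackets and moving \<open>x\<close> or
  \<open>D x\<close> across \<open>g\<close> gives the same three terms on each side. This is how
  \<phi> commuting with \<open>bracket x\<close> reads in terms of forms.\<close>

lemma sym_part_bracket:
  assumes D: "derivation D" and g: "metric_form g" and inv: "ad_invariant g"
  shows "sym_part g D (bracket x y) z = - sym_part g D y (bracket x z)"
proof -
  have d: "D (bracket x y) = bracket (D x) y + bracket x (D y)" for x y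
    using D by (simp add: derivation_def)
  have i: "g (bracket x y) z = - g y (bracket x z)" for x y z
    using inv by (simp add: ad_invariant_def)
  show ?thesis
    by (simp add: sym_part_def d metric_form_add_left[OF g] metric_form_add_right[OF g] i)
qed

text \<open>The hypothesis on \<open>y\<close> encodes \<phi> y = m y, so this is the invariance of
  the eigenspaces of \<phi> under \<open>bracket x\<close>.\<close>

lemma sym_part_eigenvector_bracket:
  assumes "derivation D" "metric_form g" "ad_invariant g"
    and y: "\<And>z. sym_part g D y z = m * g y z"
  shows "sym_part g D (bracket x y) z = m * g (bracket x y) z"
proof -
  have "g (bracket x y) z = - g y (bracket x z)"
    using assms(3) by (simp add: ad_invariant_def)
  then show ?thesis by (simp add: sym_part_bracket assms(1-3) y)
qed

text \<open>Each \<open>e i\<close> is an eigenvector of \<phi> with eigenvalue \<open>m i\<close>,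
  so the span is a sum of eigenspaces. A set \<open>S\<close> of eigenvalues is allowed in order to
  cover both an eigenspace and its complement. By the last hypothesis, pairing with a suitable
  \<open>z\<close> isolates any single coordinate.\<close>

lemma ideal_span_eigenvectors:
  assumes D: "derivation D" and g: "metric_form g" and inv: "ad_invariant g"
    and e: "indexed_basis n e"
    and m: "\<And>i z. i \<in> {1..n} \<Longrightarrow> sym_part g D (e i) z = m i * g (e i) z"
    and s: "\<And>k. k \<in> {1..n} \<Longrightarrow> \<exists>z. \<forall>i\<in>{1..n}. g (e i) z \<noteq> 0 \<longleftrightarrow> i = k"
  shows "lie_ideal (span (e ` {i\<in>{1..n}. m i \<in> S}))" (is "lie_ideal (span ?E)")
proof -
  let ?d = "dual_basis n e"
  have gen: "bracket x (e i) \<in> span ?E" if i: "i \<in> {1..n}" "m i \<in> S" for x i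
  proof -
    define u where "u = bracket x (e i)"
    have u: "u = (\<Sum>k\<in>{1..n}. ?d k u *s e k)" by (rule indexed_basis_expansion[OF e])
    have "?d k u *s e k \<in> span ?E" if k: "k \<in> {1..n}" for k
    proof -
      obtain z where z: "\<forall>i\<in>{1..n}. g (e i) z \<noteq> 0 \<longleftrightarrow> i = k" using s[OF k] by blast
      have pick: "(\<Sum>j\<in>{1..n}. c j * g (e j) z) = c k * g (e k) z" for c
      proof -
        have "(\<Sum>j\<in>{1..n}. c j * g (e j) z) = (\<Sum>j\<in>{1..n}. if j = k then c j * g (e j) z else 0)"
          by (rule sum.cong) (use z in auto)
        then show ?thesis using k by simp
      qed
      have gu: "g u z = ?d k u * g (e k) z"
        by (subst u) (simp add: metric_form_sum_left[OF g] metric_form_scale_left[OF g] pick del: One_nat_def)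
      have "sym_part g D u z = (\<Sum>j\<in>{1..n}. ?d j u * sym_part g D (e j) z)"
      proof -
        interpret Dl: Vector_Spaces.linear scale scale D using D by (simp add: derivation_def)
        show ?thesis
          by (subst u) (simp add: sym_part_def metric_form_sum_left[OF g]
              metric_form_scale_left[OF g] Dl.sum Dl.scale distrib_left sum.distrib)
      qed
      also have "\<dots> = (\<Sum>j\<in>{1..n}. (?d j u * m j) * g (e j) z)"
        by (rule sum.cong) (simp_all add: m mult.assoc)
      also have "\<dots> = ?d k u * m k * g (e k) z" by (rule pick)
      \<comment> \<open>Both sides compute \<open>sym_part g D u z\<close>: on the left
        \<open>u\<close> is an eigenvector for \<open>m i\<close>, on the right it is expanded in
        the basis. Since \<open>g (e k) z\<close> is nonzero, \<open>u\<close> has coordinates only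
        along vectors with eigenvalue \<open>m i\<close>.\<close>
      finally have "m i * (?d k u * g (e k) z) = ?d k u * m k * g (e k) z"
        using sym_part_eigenvector_bracket[OF D g inv m[OF i(1)], of x z] gu by (simp add: u_def)
      then have "?d k u = 0 \<or> m k = m i" using z k by auto
      then show ?thesis
      proof
        assume "?d k u = 0"
        then show ?thesis by (simp add: span_zero)
      next
        assume "m k = m i"
        then have "e k \<in> ?E" using k i by auto
        then show ?thesis by (intro span_scale span_base)
      qed
    qed
    then show ?thesis unfolding u_def[symmetric] by (subst u) (rule span_sum)
  qed
  have "bracket x y \<in> span ?E" if y: "y \<in> span ?E" for x y
  proof -
    interpret b: Vector_Spaces.linear scale scale "bracket x" by (rule linear_bracket_right)
    have "subspace {y. bracket x y \<in> span ?E}"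
      by (auto simp: subspace_def b.add b.scale span_zero span_add span_scale)
    with y show ?thesis by (rule span_induct) (use gen in auto)
  qed
  then show ?thesis by (simp add: lie_ideal_def)
qed

text \<open>The coordinates of a common vector are supported in both \<open>A\<close> and
  \<open>B\<close>, hence nowhere.\<close>

lemma direct_sum_span_partition:
  assumes "independent (A \<union> B)" "A \<inter> B = {}" "span (A \<union> B) = UNIV"
  shows "direct_sum (span A) (span B)"
proof -
  have "x = 0" if x: "x \<in> span A" "x \<in> span B" for x
  proof -
    let ?r = "representation (A \<union> B) x"
    have "?r = representation A x" "?r = representation B x"
      using assms(1) x by (auto intro: representation_extend)
    then have "?r b = 0" for b
      using representation_ne_zero[of A x b] representation_ne_zero[of B x b] assms(2) by auto
    then show "x = 0"
      using sum_nonzero_representation_eq[OF assms(1), of x] assms(3) by simp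
  qed
  then have "span A \<inter> span B = {0}" by (auto simp: span_zero)
  moreover have "\<exists>u\<in>span A. \<exists>w\<in>span B. x = u + w" for x
    using assms(3) by (force simp: span_Un)
  ultimately show ?thesis by (simp add: direct_sum_def)
qed

lemma irreducible_derivation_in_co:
  assumes irr: "lie_irreducible" and D: "derivation D" and e: "indexed_basis n e"
    and diag: "diagonalizes n e D" and g: "metric_form g" and inv: "ad_invariant g"
    and sd: "sigma_diagonal n e g"
  shows "D \<in> co g"
proof -
  obtain l where l: "\<And>i. i \<in> {1..n} \<Longrightarrow> D (e i) = l i *s e i"
    using diag unfolding diagonalizes_def by metis
  obtain \<sigma> where s: "\<sigma> permutes {1..n}" "\<sigma> \<circ> \<sigma> = id"
    and gs: "\<And>i j. i \<in> {1..n} \<Longrightarrow> j \<in> {1..n} \<Longrightarrow> g (e i) (e j) \<noteq> 0 \<longleftrightarrow> j = \<sigma> i"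
    using sd sigma_diagonal_iff[OF e g] by blast
  have ss: "\<sigma> (\<sigma> i) = i" for i using s(2) by (metis comp_apply id_apply)
  have endo: "endo D" using D by (simp add: derivation_def)
  interpret Dl: Vector_Spaces.linear scale scale D by (rule endo)
  \<comment> \<open>The only basis vector that pairs nontrivially with \<open>e i\<close> is
    \<open>e (\<sigma> i)\<close>, so \<open>N\<^sup>*\<close> acts on \<open>e i\<close> by
    \<open>l (\<sigma> i)\<close>.\<close>
  define m where "m i = l i + l (\<sigma> i)" for i
  let ?d = "dual_basis n e"
  have m: "sym_part g D (e i) z = m i * g (e i) z" if i: "i \<in> {1..n}" for i z
  proof -
    have z: "z = (\<Sum>k\<in>{1..n}. ?d k z *s e k)" by (rule indexed_basis_expansion[OF e])
    have "sym_part g D (e i) z = (\<Sum>k\<in>{1..n}. ?d k z * ((l i + l k) * g (e i) (e k)))"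
      by (subst z) (simp add: sym_part_def metric_form_sum_right[OF g] metric_form_scale_right[OF g]
          metric_form_scale_left[OF g] Dl.sum Dl.scale l[OF i] l sum.distrib sum_distrib_left algebra_simps)
    also have "\<dots> = (\<Sum>k\<in>{1..n}. m i * (?d k z * g (e i) (e k)))"
    proof (rule sum.cong[OF refl])
      fix k assume "k \<in> {1..n}"
      then show "?d k z * ((l i + l k) * g (e i) (e k)) = m i * (?d k z * g (e i) (e k))"
        using gs[OF i, of k] by (cases "k = \<sigma> i") (auto simp: m_def)
    qed
    also have "\<dots> = m i * g (e i) z"
      by (subst (2) z) (simp add: metric_form_sum_right[OF g] metric_form_scale_right[OF g]
          sum_distrib_left)
    finally show ?thesis .
  qed
  \<comment> \<open>The witness is \<open>e (\<sigma> k)\<close>: it pairs nontrivially with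
    \<open>e i\<close> iff \<sigma> k = \<sigma> i, and the involution \<sigma> is
    injective.\<close>
  have sep: "\<exists>z. \<forall>i\<in>{1..n}. g (e i) z \<noteq> 0 \<longleftrightarrow> i = k" if k: "k \<in> {1..n}" for k
  proof (intro exI ballI)
    fix i assume "i \<in> {1..n}"
    moreover have "\<sigma> k \<in> {1..n}" using s(1) k by (simp only: permutes_in_image)
    ultimately show "g (e i) (e (\<sigma> k)) \<noteq> 0 \<longleftrightarrow> i = k" using gs ss by metis
  qed
  have const: "m i = m j" if ij: "i \<in> {1..n}" "j \<in> {1..n}" for i j
  proof (rule ccontr)
    assume ne: "m i \<noteq> m j"
    \<comment> \<open>Splitting the basis by whether the eigenvalue equals \<open>m i\<close> yields
      complementary ideals, the first containing \<open>e i\<close> and the second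
      \<open>e j\<close>.\<close>
    let ?P = "\<lambda>S. e ` {k\<in>{1..n}. m k \<in> S}"
    have ind: "independent (e ` {1..n})" and inj: "inj_on e {1..n}" and sp: "span (e ` {1..n}) = UNIV"
      using e by (auto simp: indexed_basis_def)
    have un: "?P {m i} \<union> ?P (- {m i}) = e ` {1..n}" by auto
    have "?P {m i} \<inter> ?P (- {m i}) = {}"
      by (subst inj_on_image_Int[OF inj, symmetric]) auto
    then have ds: "direct_sum (span (?P {m i})) (span (?P (- {m i})))"
      using ind sp by (intro direct_sum_span_partition) (simp_all only: un not_False_eq_True)
    have nz: "span (?P S) \<noteq> {0}" if "k \<in> {1..n}" "m k \<in> S" for k S
    proof -
      have "e k \<in> span (?P S)" using that by (auto intro: span_base)
      moreover have "e k \<noteq> 0" using ind that(1) dependent_zero by force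
      ultimately show ?thesis by blast
    qed
    have "lie_ideal (span (?P S))" for S
      by (rule ideal_span_eigenvectors[OF D g inv e m sep])
    moreover have "span (?P {m i}) \<noteq> {0}" "span (?P (- {m i})) \<noteq> {0}"
      using nz[OF ij(1), of "{m i}"] nz[OF ij(2), of "- {m i}"] ne by simp_all
    ultimately show False using irr ds unfolding lie_irreducible_def by blast
  qed
  \<comment> \<open>For \<open>n = 0\<close> the condition is vacuous and any \<open>c\<close> will
    do.\<close>
  obtain c where c: "\<And>i. i \<in> {1..n} \<Longrightarrow> m i = c" using const by metis
  have "g (D x) y + g x (D y) = c * g x y" for x y
  proof -
    have x: "x = (\<Sum>k\<in>{1..n}. ?d k x *s e k)" by (rule indexed_basis_expansion[OF e])
    have "g (D x) y + g x (D y) = (\<Sum>k\<in>{1..n}. ?d k x * sym_part g D (e k) y)"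
      by (subst (1 2) x) (simp add: sym_part_def metric_form_sum_left[OF g]
          metric_form_scale_left[OF g] Dl.sum Dl.scale distrib_left sum.distrib)
    also have "\<dots> = (\<Sum>k\<in>{1..n}. c * (?d k x * g (e k) y))"
      by (rule sum.cong) (simp_all add: m c)
    also have "\<dots> = c * g x y"
      by (subst (2) x) (simp add: metric_form_sum_left[OF g] metric_form_scale_left[OF g]
          sum_distrib_left)
    finally show ?thesis .
  qed
  with endo show ?thesis by (auto simp: co_def)
qed

end

theorem proposition4p16:
  fixes scale :: "'k::real_normed_field \<Rightarrow> 'a::ab_group_add \<Rightarrow> 'a"
    and bracket :: "'a \<Rightarrow> 'a \<Rightarrow> 'a"
    and n :: nat and e :: "nat \<Rightarrow> 'a"
    and N :: "'a \<Rightarrow> 'a" and g :: "'a \<Rightarrow> 'a \<Rightarrow> 'k"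
  assumes "finite_dim_lie_algebra scale bracket"
    and "finite_dim_lie_algebra.lie_irreducible scale bracket"
    and "finite_dim_lie_algebra.nikolayevsky scale bracket N"
    and "finite_dim_lie_algebra.indexed_basis scale n e"
    and "finite_dim_lie_algebra.diagonalizes scale n e N"
    and "finite_dim_lie_algebra.metric_form scale g"
    and "finite_dim_lie_algebra.ad_invariant bracket g"
    and "finite_dim_lie_algebra.sigma_diagonal scale n e g"
  shows "finite_dim_lie_algebra.metric_nikolayevsky scale bracket g N"
proof -
  interpret finite_dim_lie_algebra scale bracket by (rule assms(1))
  \<comment> \<open>The trace identity holds for all derivations, in particular for those in
    \<open>co g\<close>; what remains is that \<open>N\<close> itself lies in
    \<open>co g\<close>.\<close>
  show ?thesis
    using assms irreducible_derivation_in_co[of N n e g]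
    unfolding nikolayevsky_def metric_nikolayevsky_def by blast
qed

end
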